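(* Let $\{V_n:n\in\mathbb N\}$ be a family of pairwise disjoint countable subsets of the open square $(-1,1)^2$, each $V_n$ dense in $J^2$. Then for any given maps $\omega:\mathbb N\to\mathcal A$ and $\alpha:\mathbb N\to\mathcal A'$ there exists a homeomorphism $\varphi:J^2\to J^2$ such that for every $n\in\mathbb N$ and every $x\in V_n$ one has $\omega_\varphi(x)=\omega(n)$ and $\alpha_\varphi(x)=\alpha(n)$.
   Context: $J=[-1,1]$, $J_s=J\times\{s\}$. $\mathcal A$ is the collection of all nonempty connected closed subsets of $J_1$ and $\mathcal A'$ the collection of all nonempty connected closed subsets of $J_{-1}$. For a homeomorphism $g$, $\omega_g(x)$ is the $\omega$-limit set of $x$ (set of limits of $g^{n_i}(x)$ along increasing sequences of positive integers) and $\alpha_g(x)=\omega_{g^{-1}}(x)$. *)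

theory Defs
  imports "HOL-Analysis.Analysis"
begin

definition J :: "real set" where
  "J = {-1..1}"

definition J2 :: "(real \<times> real) set" where
  "J2 = J \<times> J"

definition Jline :: "real \<Rightarrow> (real \<times> real) set" where
  "Jline s = J \<times> {s}"

definition A_top :: "(real \<times> real) set set" where
  "A_top = {C. C \<noteq> {} \<and> connected C \<and> closed C \<and> C \<subseteq> Jline 1}"

definition A_bot :: "(real \<times> real) set set" where
  "A_bot = {C. C \<noteq> {} \<and> connected C \<and> closed C \<and> C \<subseteq> Jline (-1)}"

definition omega_limit :: "('a::topological_space \<Rightarrow> 'a) \<Rightarrow> 'a \<Rightarrow> 'a set" where
  "omega_limit g x = {y. \<exists>r::nat \<Rightarrow> nat. strict_mono r \<and> ((\<lambda>i. (g ^^ r i) x) \<longlongrightarrow> y) sequentially}"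

end

theory Submission
  imports Defs "HOL-Real_Asymp.Real_Asymp"
begin

text \<open>
  In the coordinates \<open>x = tanh z\<close>, \<open>t = (artanh y + c * x) / d\<close> of the open square, every continuous
  \<open>F\<close> defines the map \<open>(z, t) \<mapsto> (z + F (t + 1) - F t, t + 1)\<close>, whose orbits have first coordinates
  \<open>tanh (z - F t + F (t + n))\<close> and second coordinates tending to \<open>1\<close>. By the addition formula for
  \<open>tanh\<close> it extends continuously to the whole square, being the identity on the top and bottom edges,
  as soon as \<open>F (t + 1) - F t\<close> tends to \<open>0\<close> at \<open>\<plusminus>\<infinity>\<close>.

  For generic \<open>c\<close> and \<open>d\<close> the points of the countable set \<open>\<Union>n. V n\<close> have values of \<open>t\<close> that are
  pairwise distinct modulo \<open>1\<close>. Hence \<open>F\<close> can be prescribed independently along all sequences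
  \<open>t\<^sub>j + n\<close>: it is a sum of bumps around \<open>t\<^sub>j + \<int>\<close> which slowly become narrower as \<open>\<bar>t\<bar>\<close> grows,
  the height of the \<open>j\<close>-th family slowly sweeping back and forth over the prescribed interval.
\<close>

subsection \<open>Slowly sweeping functions\<close>

definition cluster_set :: "(nat \<Rightarrow> 'a::topological_space) \<Rightarrow> 'a set" where
  "cluster_set b = {y. \<exists>r::nat \<Rightarrow> nat. strict_mono r \<and> (\<lambda>i. b (r i)) \<longlonglongrightarrow> y}"

lemma cluster_setI:
  fixes b :: "nat \<Rightarrow> 'a::metric_space"
  assumes "\<And>e N. e > 0 \<Longrightarrow> \<exists>n\<ge>N. dist (b n) y < e"
  shows "y \<in> cluster_set b"
proof -
  have "\<exists>r. \<forall>n. dist (b (r n)) y < inverse (real (Suc n)) \<and> r n < r (Suc n)"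
  proof (rule dependent_nat_choice)
    show "\<exists>x. dist (b x) y < inverse (real (Suc 0))" using assms[of 1 0] by auto
    show "\<exists>z. dist (b z) y < inverse (real (Suc (Suc n))) \<and> x < z" for x n
      using assms[of "inverse (real (Suc (Suc n)))" "Suc x"] by auto
  qed
  then obtain r where r: "\<And>n. dist (b (r n)) y < inverse (real (Suc n))" "\<And>n. r n < r (Suc n)" by auto
  have "(\<lambda>i. dist (b (r i)) y) \<longlonglongrightarrow> 0"
    by (rule tendsto_sandwich[OF _ _ tendsto_const LIMSEQ_inverse_real_of_nat])
       (auto intro!: always_eventually less_imp_le r simp del: of_nat_Suc)
  then have "(\<lambda>i. b (r i)) \<longlonglongrightarrow> y" by (simp add: tendsto_dist_iff[symmetric])
  then show ?thesis using r(2) by (auto simp: cluster_set_def strict_mono_Suc_iff)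
qed

lemma tanh_artanh_real [simp]:
  fixes x :: real
  assumes "\<bar>x\<bar> < 1"
  shows "tanh (artanh x) = x"
proof -
  have "exp (- 2 * artanh x) = (1 - x) / (1 + x)"
    using assms by (simp add: artanh_def exp_minus field_simps)
  then show ?thesis using assms unfolding tanh_real_altdef by (simp only:) (simp add: divide_simps)
qed

text \<open>The logarithm makes the oscillation so slow that the derivative stays bounded although
  the swings grow without bound in both directions. Squaring and adding 1 keeps the formula smooth
  at 0.\<close>

definition osc :: "real \<Rightarrow> real" where "osc s = s * sin (ln (1 + s\<^sup>2))"

lemma osc_0 [simp]: "osc 0 = 0" by (simp add: osc_def)

lemma osc_has_derivative:
  "(osc has_real_derivative (sin (ln (1 + s\<^sup>2)) + 2 * (s\<^sup>2 / (1 + s\<^sup>2)) * cos (ln (1 + s\<^sup>2)))) (at s)"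
proof -
  have "1 + s\<^sup>2 > 0" by (simp add: add_pos_nonneg)
  then show ?thesis unfolding osc_def[abs_def]
    by (auto intro!: derivative_eq_intros simp: power2_eq_square divide_simps)
qed

text \<open>The derivative is a sine plus twice a product of a factor in [0,1] with a cosine, hence
  at most 1 + 2 in absolute value.\<close>

lemma osc_lipschitz: "\<bar>osc x - osc y\<bar> \<le> 3 * \<bar>x - y\<bar>"
proof -
  have "norm (osc x - osc y) \<le> 3 * norm (x - y)"
  proof (rule field_differentiable_bound[where S=UNIV and f'="\<lambda>s. sin (ln (1 + s\<^sup>2)) + 2 * (s\<^sup>2 / (1 + s\<^sup>2)) * cos (ln (1 + s\<^sup>2))"])
    fix s :: real
    have "0 \<le> s\<^sup>2 / (1 + s\<^sup>2)" "s\<^sup>2 / (1 + s\<^sup>2) \<le> 1" by (auto simp: divide_simps add_pos_nonneg)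
    then have "\<bar>(s\<^sup>2 / (1 + s\<^sup>2)) * cos (ln (1 + s\<^sup>2))\<bar> \<le> 1 * 1"
      unfolding abs_mult by (intro mult_mono) auto
    then show "norm (sin (ln (1 + s\<^sup>2)) + 2 * (s\<^sup>2 / (1 + s\<^sup>2)) * cos (ln (1 + s\<^sup>2))) \<le> 3"
      using abs_sin_le_one[of "ln (1 + s\<^sup>2)"] by (simp only: real_norm_def mult.assoc)
  qed (simp_all only: has_field_derivative_at_within osc_has_derivative convex_UNIV UNIV_I)
  then show ?thesis by simp
qed

lemma osc_attains_value: "\<exists>s\<ge>m. osc s = z"
proof -
  \<comment> \<open>These are the points where the sine in \<open>osc\<close> is alternately 1 and
    -1, so that \<open>osc\<close> takes the values \<open>S k\<close> and \<open>- S k\<close> at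
    even and odd \<open>k\<close>. The intermediate value theorem between two consecutive ones gives
    \<open>z\<close>.\<close>
  define S where "S k = sqrt (exp (pi/2 + pi * of_int k) - 1)" for k :: int
  have S: "ln (1 + (S k)\<^sup>2) = pi/2 + pi * of_int k" if "k \<ge> 0" for k
    using that unfolding S_def by simp
  have lim: "filterlim (\<lambda>n. sqrt (exp (pi/2 + pi * real n) - 1)) at_top sequentially"
    by real_asymp
  then have "\<forall>\<^sub>F n in sequentially. sqrt (exp (pi/2 + pi * real n) - 1) \<ge> max m \<bar>z\<bar>"
    by (simp only: filterlim_at_top)
  then obtain N where N: "\<And>n. n \<ge> N \<Longrightarrow> S (int n) \<ge> max m \<bar>z\<bar>"
    unfolding S_def by (auto simp: eventually_sequentially)
  let ?a = "S (int (2*N))" and ?b = "S (int (2*N+1))"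
  have "sin (pi/2 + pi * of_int (int (2*N))) = 1"
    using cos_2npi[of N] by (simp add: sin_add mult_ac)
  then have a: "osc ?a = ?a" unfolding osc_def by (subst S) simp_all
  have "sin (pi/2 + pi * of_int (int (2*N+1))) = -1"
    using cos_2npi[of N] sin_2npi[of N] sin_3over2_pi by (simp add: sin_add distrib_left mult_ac)
  then have b: "osc ?b = - ?b" unfolding osc_def by (subst S) simp_all
  have "?a \<le> ?b" by (simp add: S_def)
  moreover have "\<forall>x. isCont osc x" using DERIV_isCont osc_has_derivative by blast
  moreover have "z \<le> osc ?a" "osc ?b \<le> z" using a b N[of "2*N"] N[of "2*N+1"] by auto
  ultimately obtain x where "x \<ge> ?a" "osc x = z"
    using IVT2[of osc ?b z ?a] by auto
  moreover have "m \<le> ?a" using N[of "2*N"] by auto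
  ultimately show ?thesis using order_trans by blast
qed

text \<open>A sequence with small steps cannot jump over a solution \<open>x\<close> of
  \<open>osc x = z\<close>. The first late term beyond \<open>x\<close> is within e/3 of it, and the
  Lipschitz constant 3 turns this into e.\<close>

lemma osc_cluster:
  fixes s :: "nat \<Rightarrow> real"
  assumes s: "filterlim s at_top sequentially" and ds: "(\<lambda>n. s (Suc n) - s n) \<longlonglongrightarrow> 0"
    and e: "e > 0"
  shows "\<exists>n\<ge>N. \<bar>osc (s n) - z\<bar> < e"
proof -
  obtain M where M: "\<And>n. n \<ge> M \<Longrightarrow> \<bar>s (Suc n) - s n\<bar> < e / 3"
    using LIMSEQ_D[OF ds, of "e/3"] e by auto
  define N' where "N' = max M N"
  obtain x where x: "x \<ge> s N'" "osc x = z" using osc_attains_value by blast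
  have "\<forall>\<^sub>F n in sequentially. s n > x \<and> n \<ge> N'"
    using s eventually_ge_at_top by (auto simp: filterlim_at_top_dense eventually_conj)
  then obtain n0 where "s n0 > x \<and> n0 \<ge> N'" by (auto simp: eventually_sequentially)
  define n where "n = (LEAST n. s n > x \<and> n \<ge> N')"
  have n: "s n > x" "n \<ge> N'"
    using LeastI[of "\<lambda>n. s n > x \<and> n \<ge> N'", OF \<open>s n0 > x \<and> n0 \<ge> N'\<close>] by (auto simp: n_def)
  with x(1) have "n > N'" by (cases "n = N'") auto
  then obtain k where k: "n = Suc k" "k \<ge> N'" by (cases n) auto
  then have "s k \<le> x" using not_less_Least[of k "\<lambda>n. s n > x \<and> n \<ge> N'"] by (auto simp: n_def not_less)
  moreover have "\<bar>s n - s k\<bar> < e / 3" using M[of k] k by (auto simp: N'_def)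
  ultimately have "\<bar>s n - x\<bar> < e / 3" using n by auto
  then have "\<bar>osc (s n) - z\<bar> < e" using osc_lipschitz[of "s n" x] x(2) by auto
  then show ?thesis using n(2) by (auto simp: N'_def)
qed

text \<open>For p = 1 or p = -1 an unbounded linear \<open>f\<close> is needed. Otherwise the target
  \<open>artanh p - k\<close>, clamped to [-s, s], is reached after finite time with
  \<open>f 0 = 0\<close>.\<close>

lemma exists_lipschitz_drift:
  fixes p k :: real
  assumes "\<bar>p\<bar> \<le> 1"
  shows "\<exists>f. f 0 = 0 \<and> (\<forall>x y. \<bar>f x - f y\<bar> \<le> \<bar>x - y\<bar>) \<and> ((\<lambda>s. tanh (k + f s)) \<longlongrightarrow> p) at_top"
proof -
  consider "p = 1" | "p = -1" | "\<bar>p\<bar> < 1" using assms by linarith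
  then show ?thesis
  proof cases
    case 1
    have "((\<lambda>s. tanh (k + s)) \<longlongrightarrow> 1) at_top" 
      by (rule filterlim_compose[OF tanh_real_at_top]) real_asymp
    then show ?thesis using 1 by (intro exI[of _ "\<lambda>s. s"]) auto
  next
    case 2
    have "((\<lambda>s. tanh (k + - s)) \<longlongrightarrow> -1) at_top" 
      by (rule filterlim_compose[OF tanh_real_at_bot]) real_asymp
    then show ?thesis using 2 by (intro exI[of _ "\<lambda>s. -s"]) auto
  next
    case 3
    define v where "v = artanh p - k"
    define f where "f s = max (-s) (min s v)" for s
    have "\<forall>\<^sub>F s in at_top. tanh (k + f s) = p"
      using eventually_ge_at_top[of "\<bar>v\<bar>"]
    proof eventually_elim
      case (elim s)
      then have "f s = v" by (auto simp: f_def)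
      then show ?case using 3 by (simp add: v_def)
    qed
    then have "((\<lambda>s. tanh (k + f s)) \<longlongrightarrow> p) at_top" by (rule tendsto_eventually)
    then show ?thesis by (intro exI[of _ f]) (auto simp: f_def)
  qed
qed

text \<open>Clamping \<open>osc\<close> between two drifts towards \<open>p\<close> and
  \<open>q\<close> confines all limits to [p,q], while \<open>osc\<close> itself comes near every
  real number along slow sequences. Here \<open>k\<close> stands for the starting value of an orbit
  in the tanh coordinate.\<close>

lemma exists_lipschitz_sweep:
  fixes p q k :: real
  assumes p: "-1 \<le> p" and pq: "p \<le> q" and q: "q \<le> 1"
  shows "\<exists>f. f 0 = 0 \<and> (\<forall>x y. \<bar>f x - f y\<bar> \<le> 3 * \<bar>x - y\<bar>) \<and>
    (\<forall>s. filterlim s at_top sequentially \<longrightarrow> (\<lambda>n. s (Suc n) - s n) \<longlonglongrightarrow> 0 \<longrightarrow>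
      cluster_set (\<lambda>n. tanh (k + f (s n))) = {p..q})"
proof -
  obtain lo :: "real \<Rightarrow> real" where lo: "lo 0 = 0" "\<And>x y. \<bar>lo x - lo y\<bar> \<le> \<bar>x - y\<bar>"
      "((\<lambda>s. tanh (k + lo s)) \<longlongrightarrow> p) at_top"
    using exists_lipschitz_drift[of p k] p pq q by (metis abs_le_iff minus_le_iff order_trans)
  obtain hi where hi: "hi 0 = 0" "\<And>x y. \<bar>hi x - hi y\<bar> \<le> \<bar>x - y\<bar>"
      "((\<lambda>s. tanh (k + hi s)) \<longlongrightarrow> q) at_top"
    using exists_lipschitz_drift[of q k] p pq q by (metis abs_le_iff minus_le_iff order_trans)
  \<comment> \<open>The moving bounds keep \<open>f\<close> finite and \<open>f 0 = 0\<close> even when \<open>p\<close> or \<open>q\<close> is \<open>\<plusminus>1\<close>.\<close>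
  define f where "f s = max (lo s) (min (hi s) (osc s))" for s
  have lip: "\<bar>f x - f y\<bar> \<le> 3 * \<bar>x - y\<bar>" for x y
    using lo(2)[of x y] hi(2)[of x y] osc_lipschitz[of x y] unfolding f_def max_def min_def by (smt (verit, best))
  have mono: "mono (\<lambda>v. tanh (k + v))" by (auto intro: monoI)
  have f_eq: "tanh (k + f s) = max (tanh (k + lo s)) (min (tanh (k + hi s)) (tanh (k + osc s)))" for s
    by (simp add: f_def max_of_mono[OF mono] min_of_mono[OF mono])
  have "cluster_set (\<lambda>n. tanh (k + f (s n))) = {p..q}"
    if s: "filterlim s at_top sequentially" "(\<lambda>n. s (Suc n) - s n) \<longlonglongrightarrow> 0" for s
  proof (intro equalityI subsetI)
    fix y assume "y \<in> cluster_set (\<lambda>n. tanh (k + f (s n)))"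
    then obtain r where r: "strict_mono r" "(\<lambda>i. tanh (k + f (s (r i)))) \<longlonglongrightarrow> y"
      by (auto simp: cluster_set_def)
    have sr: "filterlim (\<lambda>i. s (r i)) at_top sequentially"
      using s(1) r(1) filterlim_compose filterlim_subseq by blast
    note L = filterlim_compose[OF lo(3) sr] and H = filterlim_compose[OF hi(3) sr]
    have "p \<le> y"
      by (rule LIMSEQ_le[OF L r(2)]) (auto simp: f_eq)
    moreover have "y \<le> max p q"
      by (rule LIMSEQ_le[OF r(2) tendsto_max[OF L H]]) (auto simp: f_eq)
    ultimately show "y \<in> {p..q}" using pq by auto
  next
    fix y assume y: "y \<in> {p..q}"
    have "y \<in> cluster_set (\<lambda>n. tanh (k + osc (s n)))"
    proof (rule cluster_setI)
      fix e :: real and N :: nat assume e: "e > 0"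
      define e' where "e' = min e 1"
      have e': "0 < e'" "e' \<le> 1" "e' \<le> e" using e by (auto simp: e'_def)
      \<comment> \<open>The target may be an endpoint of [-1,1], where there is no inverse of tanh,
        so it is first moved inwards by at most e'/2.\<close>
      define y' where "y' = max (-1 + e'/2) (min (1 - e'/2) y)"
      have y': "\<bar>y'\<bar> < 1" "\<bar>y' - y\<bar> \<le> e'/2"
        using e' y p q unfolding y'_def max_def min_def by (auto simp: abs_le_iff)
      have "isCont tanh (artanh y')" by (intro continuous_intros) (auto)
      then obtain d where d: "d > 0" "\<And>x. \<bar>x - artanh y'\<bar> < d \<Longrightarrow> \<bar>tanh x - tanh (artanh y')\<bar> < e'/2"
        unfolding continuous_at_eps_delta dist_real_def using half_gt_zero[OF e'(1)] by blast
      obtain n where "n \<ge> N" "\<bar>osc (s n) - (artanh y' - k)\<bar> < d"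
        using osc_cluster[OF s d(1)] by blast
      then have "\<bar>tanh (k + osc (s n)) - y'\<bar> < e'/2"
        using d(2)[of "k + osc (s n)"] y'(1) by (auto simp: algebra_simps)
      then have "dist (tanh (k + osc (s n))) y < e" using y'(2) e' unfolding dist_real_def by linarith
      then show "\<exists>n\<ge>N. dist (tanh (k + osc (s n))) y < e" using \<open>n \<ge> N\<close> by blast
    qed
    then obtain r where r: "strict_mono r" "(\<lambda>i. tanh (k + osc (s (r i)))) \<longlonglongrightarrow> y"
      by (auto simp: cluster_set_def)
    have sr: "filterlim (\<lambda>i. s (r i)) at_top sequentially"
      using s(1) r(1) filterlim_compose filterlim_subseq by blast
    \<comment> \<open>Clamping commutes with taking limits, and it does not move \<open>y\<close>
      because \<open>y\<close> lies between \<open>p\<close> and \<open>q\<close>.\<close>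
    have "(\<lambda>i. tanh (k + f (s (r i)))) \<longlonglongrightarrow> max p (min q y)"
      unfolding f_eq
      by (intro tendsto_max tendsto_min r(2) filterlim_compose[OF lo(3) sr] filterlim_compose[OF hi(3) sr])
    then show "y \<in> cluster_set (\<lambda>n. tanh (k + f (s n)))"
      using r(1) y by (auto simp: cluster_set_def)
  qed
  then show ?thesis using lip lo(1) hi(1) by (intro exI[of _ f]) (auto simp: f_def)
qed

subsection \<open>Homeomorphisms of the square\<close>

text \<open>The addition formula of tanh: for |t| < 1 this is translation by \<open>artanh t\<close>
  in the coordinate \<open>artanh x\<close>, written so that it makes sense on the closed interval
  and fixes its endpoints.\<close>

definition mobius :: "real \<Rightarrow> real \<Rightarrow> real" where
  "mobius t x = (x + t) / (1 + t * x)"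

lemma mobius_denom_pos:
  fixes t x :: real
  assumes "\<bar>t\<bar> < 1" "\<bar>x\<bar> \<le> 1"
  shows "1 + t * x > 0"
proof -
  have "\<bar>t * x\<bar> \<le> \<bar>t\<bar> * 1"
    unfolding abs_mult using assms by (intro mult_left_mono) auto
  then show ?thesis using assms by linarith
qed

lemma abs_mobius_le:
  assumes "\<bar>t\<bar> < 1" "\<bar>x\<bar> \<le> 1"
  shows "\<bar>mobius t x\<bar> \<le> 1"
proof -
  have "0 \<le> (1 - t) * (1 - x)" "0 \<le> (1 + t) * (1 + x)"
    using assms by auto
  then have "\<bar>x + t\<bar> \<le> 1 + t * x" by (auto simp: algebra_simps abs_le_iff)
  then show ?thesis using mobius_denom_pos[OF assms] by (simp add: mobius_def)
qed

lemma mobius_minus_mobius: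
  assumes "\<bar>t\<bar> < 1" "\<bar>x\<bar> \<le> 1"
  shows "mobius (-t) (mobius t x) = x"
proof -
  note pos = mobius_denom_pos[OF assms]
  have "t * t < 1" using assms(1) by (metis abs_square_less_1 power2_eq_square)
  have "1 - t * ((x + t) / (1 + t * x)) = (1 - t * t) / (1 + t * x)"
    using pos by (simp add: field_simps)
  moreover have "(x + t) / (1 + t * x) - t = x * (1 - t * t) / (1 + t * x)"
    using pos by (simp add: field_simps)
  ultimately show ?thesis using pos \<open>t * t < 1\<close> by (simp add: mobius_def)
qed

lemma mobius_1 [simp]: "\<bar>t\<bar> < 1 \<Longrightarrow> mobius t 1 = 1"
  by (simp add: mobius_def)

lemma mobius_neg_1 [simp]: "\<bar>t\<bar> < 1 \<Longrightarrow> mobius t (-1) = -1"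
  by (simp add: mobius_def divide_simps)

lemma abs_tanh_less_1 [simp]: "\<bar>tanh (x::real)\<bar> < 1"
  using tanh_real_bounds[of x] by auto

lemma mobius_tanh: "mobius (tanh a) (tanh b) = tanh (b + a)"
  by (simp add: mobius_def tanh_add mult_ac)

lemma artanh_mobius_tanh:
  assumes "\<bar>y\<bar> < 1"
  shows "artanh (mobius (tanh a) y) = artanh y + a"
  using mobius_tanh[of a "artanh y"] assms by (simp add: artanh_tanh_real)

lemma abs_mobius_tanh_less:
  assumes "\<bar>y\<bar> < 1"
  shows "\<bar>mobius (tanh a) y\<bar> < 1"
  using mobius_tanh[of a "artanh y"] assms by simp

section \<open>The sheared time coordinate and the maps that advance it by one\<close>

definition height :: "real \<Rightarrow> real \<Rightarrow> real \<times> real \<Rightarrow> real" where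
  "height c d p = (artanh (snd p) + c * fst p) / d"

text \<open>On the top and bottom edges the height is infinite; the value 0 there is the limit from
  inside when the increments of \<open>F\<close> vanish at infinity.\<close>

definition drift :: "(real \<Rightarrow> real) \<Rightarrow> real \<Rightarrow> real \<Rightarrow> real \<times> real \<Rightarrow> real" where
  "drift F c d p = (if \<bar>snd p\<bar> < 1 then F (height c d p + 1) - F (height c d p) else 0)"

text \<open>
  The second component makes \<open>height c d\<close> increase by exactly \<open>1\<close>. Reversing \<open>d\<close> and the argument of \<open>F\<close>
  gives the inverse.
\<close>

definition square_map :: "(real \<Rightarrow> real) \<Rightarrow> real \<Rightarrow> real \<Rightarrow> real \<times> real \<Rightarrow> real \<times> real" where
  "square_map F c d p = (let x = mobius (tanh (drift F c d p)) (fst p)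
     in (x, mobius (tanh (d + c * (fst p - x))) (snd p)))"

lemma mem_J2: "p \<in> J2 \<longleftrightarrow> \<bar>fst p\<bar> \<le> 1 \<and> \<bar>snd p\<bar> \<le> 1"
  by (cases p) (auto simp: J2_def J_def)

lemma square_map_in_J2: "p \<in> J2 \<Longrightarrow> square_map F c d p \<in> J2"
  by (simp add: square_map_def Let_def mem_J2 abs_mobius_le)

lemma height_square_map:
  assumes "\<bar>snd p\<bar> < 1" "d \<noteq> 0"
  shows "height c d (square_map F c d p) = height c d p + 1"
  using assms by (simp add: height_def square_map_def Let_def artanh_mobius_tanh field_simps)

lemma snd_square_map_less: "\<bar>snd p\<bar> < 1 \<Longrightarrow> \<bar>snd (square_map F c d p)\<bar> < 1"
  by (simp add: square_map_def Let_def abs_mobius_tanh_less)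

lemma height_uminus: "height c (-d) p = - height c d p"
  by (simp add: height_def)

text \<open>If a point has height h, its image has height \<open>- (h + 1)\<close> for the parameter
  \<open>-d\<close>. The reflected function therefore contributes F h - F (h + 1), the opposite of
  the forward drift.\<close>

lemma drift_inverse:
  assumes "p \<in> J2" "d \<noteq> 0"
  shows "drift (\<lambda>t. F (-t)) c (-d) (square_map F c d p) = - drift F c d p"
proof (cases "\<bar>snd p\<bar> < 1")
  case True
  then show ?thesis
    using height_square_map[OF True assms(2), of c F] snd_square_map_less[OF True, of F c d]
    by (simp add: drift_def height_uminus add.commute)
next
  case False
  then have "snd p = 1 \<or> snd p = -1" using assms by (auto simp: mem_J2)
  then have "\<bar>snd (square_map F c d p)\<bar> = 1" by (auto simp: square_map_def Let_def)
  then show ?thesis using False by (simp add: drift_def)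
qed

text \<open>Opposite drift restores the first coordinate. Then the shear correction
  \<open>c * (fst p - x)\<close> also changes sign, so the second translation is undone as
  well.\<close>

lemma square_map_inverse:
  assumes "p \<in> J2" "d \<noteq> 0"
  shows "square_map (\<lambda>t. F (-t)) c (-d) (square_map F c d p) = p"
proof -
  define x where "x = mobius (tanh (drift F c d p)) (fst p)"
  define y where "y = mobius (tanh (d + c * (fst p - x))) (snd p)"
  have p: "\<bar>fst p\<bar> \<le> 1" "\<bar>snd p\<bar> \<le> 1" using assms(1) by (auto simp: mem_J2)
  have xy: "square_map F c d p = (x, y)" by (simp add: square_map_def Let_def x_def y_def)
  have x: "mobius (- tanh (drift F c d p)) x = fst p"
    unfolding x_def using p by (intro mobius_minus_mobius) auto
  have y: "mobius (- tanh (d + c * (fst p - x))) y = snd p"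
    unfolding y_def using p by (intro mobius_minus_mobius) auto
  have "-d + c * (x - fst p) = - (d + c * (fst p - x))" by (simp add: algebra_simps)
  then show ?thesis
    using drift_inverse[OF assms, of F c]
    unfolding xy by (simp only: square_map_def Let_def fst_conv snd_conv tanh_minus x y prod.collapse)
qed

text \<open>Near the edges \<open>artanh (snd q)\<close> is unbounded, while the shear contributes
  at most \<open>\<bar>c\<bar>\<close>.\<close>

lemma filterlim_height:
  assumes d: "d \<noteq> 0" and p: "\<bar>snd p\<bar> = 1"
  shows "filterlim (height c d) at_infinity (at p within {q \<in> J2. \<bar>snd q\<bar> < 1})"
proof -
  have "\<forall>\<^sub>F q in at p within {q \<in> J2. \<bar>snd q\<bar> < 1}. R \<le> norm (height c d q)" for R
  proof -
    define M where "M = R * \<bar>d\<bar> + \<bar>c\<bar>"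
    have "\<forall>\<^sub>F q in at p within {q \<in> J2. \<bar>snd q\<bar> < 1}. \<bar>snd q\<bar> > tanh M"
    proof (rule order_tendstoD(1))
      show "((\<lambda>q. \<bar>snd q\<bar>) \<longlongrightarrow> \<bar>snd p\<bar>) (at p within {q \<in> J2. \<bar>snd q\<bar> < 1})"
        by (intro tendsto_intros)
    qed (use p tanh_real_lt_1[of M] in simp)
    moreover have "\<forall>\<^sub>F q in at p within {q \<in> J2. \<bar>snd q\<bar> < 1}. q \<in> J2 \<and> \<bar>snd q\<bar> < 1"
      by (auto simp: eventually_at_filter)
    ultimately show ?thesis
    proof eventually_elim
      case (elim q)
      have "tanh \<bar>artanh (snd q)\<bar> = \<bar>snd q\<bar>" using elim by simp
      then have "tanh M < tanh \<bar>artanh (snd q)\<bar>" using elim by simp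
      then have "M < \<bar>artanh (snd q)\<bar>" by (simp del: tanh_real_abs)
      moreover have "\<bar>c * fst q\<bar> \<le> \<bar>c\<bar>"
        using elim by (auto simp: abs_mult mem_J2 mult_left_le)
      ultimately have "R * \<bar>d\<bar> \<le> \<bar>artanh (snd q) + c * fst q\<bar>" by (simp add: M_def)
      then show ?case using d by (simp add: height_def pos_le_divide_eq)
    qed
  qed
  then show ?thesis by (auto simp: filterlim_at_infinity[OF order.refl])
qed

text \<open>Where |snd p| < 1 the formula is a composition of continuous functions. At an edge point
  the limit is computed separately along the interior, where the height goes to infinity, and along
  the edges, where the drift is constantly 0.\<close>

lemma continuous_on_drift:
  assumes F: "continuous_on UNIV F" and incr: "((\<lambda>t. F (t + 1) - F t) \<longlongrightarrow> 0) at_infinity"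
    and d: "d \<noteq> 0"
  shows "continuous_on J2 (drift F c d)"
  unfolding continuous_on_def
proof
  fix p assume p: "p \<in> J2"
  let ?g = "\<lambda>q. F (height c d q + 1) - F (height c d q)"
  let ?I = "{q \<in> J2. \<bar>snd q\<bar> < 1}" and ?B = "{q \<in> J2. \<bar>snd q\<bar> = 1}"
  have J2: "J2 = ?I \<union> ?B" by (auto simp: mem_J2)
  show "(drift F c d \<longlongrightarrow> drift F c d p) (at p within J2)"
  proof (cases "\<bar>snd p\<bar> < 1")
    case True
    have op: "open {q::real\<times>real. \<bar>snd q\<bar> < 1}"
      by (intro open_Collect_less continuous_intros)
    have "continuous_on {q. \<bar>snd q\<bar> < 1} ?g"
      unfolding height_def using d
      by (intro continuous_intros continuous_on_compose2[OF F]
            continuous_on_compose2[OF continuous_on_artanh[OF order.refl]])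
         (auto simp: abs_less_iff)
    then have "isCont ?g p" using continuous_on_eq_continuous_at[OF op] True by blast
    then have "(?g \<longlongrightarrow> ?g p) (at p within J2)"
      unfolding isCont_def by (rule Lim_at_imp_Lim_at_within)
    moreover have "\<forall>\<^sub>F q in at p within J2. ?g q = drift F c d q"
    proof -
      have "\<forall>\<^sub>F q in at p within J2. q \<in> {q. \<bar>snd q\<bar> < 1}"
        using op True unfolding eventually_at_topological by blast
      then show ?thesis by eventually_elim (simp add: drift_def)
    qed
    moreover have "drift F c d p = ?g p" using True by (simp add: drift_def)
    ultimately show ?thesis by (simp only:) (rule Lim_transform_eventually)
  next
    case False
    then have 1: "\<bar>snd p\<bar> = 1" using p by (auto simp: mem_J2)
    have "(?g \<longlongrightarrow> 0) (at p within ?I)"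
      using filterlim_compose[OF incr filterlim_height[OF d 1]] .
    then have "(drift F c d \<longlongrightarrow> 0) (at p within ?I)"
      by (rule Lim_transform_eventually) (auto simp: eventually_at_filter drift_def)
    moreover have "(drift F c d \<longlongrightarrow> 0) (at p within ?B)"
      by (rule Lim_transform_eventually[OF tendsto_const]) (auto simp: eventually_at_filter drift_def)
    ultimately have "(drift F c d \<longlongrightarrow> 0) (at p within ?I \<union> ?B)" by (rule Lim_Un)
    then show ?thesis using 1 J2 by (simp add: drift_def)
  qed
qed

lemma continuous_on_square_map:
  assumes "continuous_on UNIV F" "((\<lambda>t. F (t + 1) - F t) \<longlongrightarrow> 0) at_infinity" "d \<noteq> 0"
  shows "continuous_on J2 (square_map F c d)"
proof -
  note drift = continuous_on_drift[OF assms, of c]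
  have denom: "1 + tanh u * v \<noteq> 0" if "\<bar>v\<bar> \<le> 1" for u v :: real
    using mobius_denom_pos[of "tanh u" v] that by auto
  have x: "continuous_on J2 (\<lambda>p. mobius (tanh (drift F c d p)) (fst p))"
    unfolding mobius_def
    by (intro continuous_intros drift) (auto simp: mem_J2 denom)
  have "continuous_on J2 (\<lambda>p. mobius (tanh (d + c * (fst p - mobius (tanh (drift F c d p)) (fst p)))) (snd p))"
    unfolding mobius_def[of _ "snd _"]
    by (intro continuous_intros x) (auto simp: mem_J2 denom)
  with x show ?thesis
    unfolding square_map_def Let_def by (rule continuous_on_Pair)
qed

lemma homeomorphism_square_map:
  assumes F: "continuous_on UNIV F" "((\<lambda>t. F (t + 1) - F t) \<longlongrightarrow> 0) at_infinity" and d: "d \<noteq> 0"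
  shows "homeomorphism J2 J2 (square_map F c d) (square_map (\<lambda>t. F (-t)) c (-d))"
proof -
  have F': "continuous_on UNIV (\<lambda>t. F (-t))"
    using F(1) by (rule continuous_on_compose2) (auto intro: continuous_intros)
  have tops: "((\<lambda>t. F (t + 1) - F t) \<longlongrightarrow> 0) at_top" "((\<lambda>t. F (t + 1) - F t) \<longlongrightarrow> 0) at_bot"
    using F(2) by (auto simp: at_infinity_eq_at_top_bot filterlim_def filtermap_sup)
  \<comment> \<open>The increment of the reflected function at \<open>t\<close> is minus the
    increment of \<open>F\<close> at \<open>- t - 1\<close>, so the two ends of the line exchange
    their roles.\<close>
  have "filterlim (\<lambda>t::real. - t - 1) at_top at_bot" "filterlim (\<lambda>t::real. - t - 1) at_bot at_top"
    by real_asymp+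
  from filterlim_compose[OF tops(1) this(1)] filterlim_compose[OF tops(2) this(2)]
  have "((\<lambda>t. F (- t) - F (- t - 1)) \<longlongrightarrow> 0) at_infinity"
    by (simp add: at_infinity_eq_at_top_bot filterlim_sup)
  from tendsto_minus[OF this]
  have incr': "((\<lambda>t. F (- (t + 1)) - F (- t)) \<longlongrightarrow> 0) at_infinity" by (simp add: algebra_simps)
  have inv: "square_map (\<lambda>t. F (-t)) c (-d) (square_map F c d p) = p"
    "square_map F c d (square_map (\<lambda>t. F (-t)) c (-d) p) = p" if "p \<in> J2" for p
    using square_map_inverse[OF that d, of F c] square_map_inverse[OF that, of "-d" "\<lambda>t. F (-t)" c] d
    by auto
  show ?thesis
    by (rule homeomorphismI)
       (use continuous_on_square_map[OF F d, of c] continuous_on_square_map[OF F' incr', of "-d" c] d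
          square_map_in_J2 inv in auto)
qed

text \<open>Heights along the orbit are t, t + 1, t + 2 and so on, so the drifts telescope to F (t +
  n) - F t, and the shear corrections telescope too.\<close>

lemma square_map_orbit:
  fixes F :: "real \<Rightarrow> real" and c d z l :: real
  assumes d: "d \<noteq> 0"
  defines "t \<equiv> height c d (tanh z, tanh l)"
  defines "x \<equiv> \<lambda>n. tanh (z - F t + F (t + real n))"
  shows "(square_map F c d ^^ n) (tanh z, tanh l) = (x n, tanh (l + real n * d + c * (tanh z - x n)))"
proof (induction n)
  case 0
  then show ?case by (simp add: x_def)
next
  case (Suc n)
  let ?p = "(x n, tanh (l + real n * d + c * (tanh z - x n)))"
  have h: "height c d ?p = t + real n"
    using d by (simp add: height_def t_def artanh_tanh_real field_simps)
  have "fst (square_map F c d ?p) = x (Suc n)"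
    by (simp add: square_map_def Let_def drift_def h) (simp add: x_def mobius_tanh algebra_simps)
  moreover have "square_map F c d ?p = (fst (square_map F c d ?p),
      tanh (l + real n * d + c * (tanh z - x n) + (d + c * (x n - fst (square_map F c d ?p)))))"
    by (simp add: square_map_def Let_def mobius_tanh)
  ultimately have "square_map F c d ?p = (x (Suc n), tanh (l + real (Suc n) * d + c * (tanh z - x (Suc n))))"
    by (simp add: algebra_simps)
  then show ?case using Suc by simp
qed

text \<open>The argument of tanh in the second coordinate is \<open>real n * d\<close> up to a
  bounded error, so that coordinate converges to \<open>sgn d\<close> and only the first one can
  have several limits. Both signs of \<open>d\<close> are allowed in order to cover the inverse
  map.\<close>

lemma omega_limit_square_map:
  fixes F :: "real \<Rightarrow> real" and c d z l :: real
  assumes d: "d \<noteq> 0"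
  defines "t \<equiv> height c d (tanh z, tanh l)"
  shows "omega_limit (square_map F c d) (tanh z, tanh l) =
    cluster_set (\<lambda>n. tanh (z - F t + F (t + real n))) \<times> {sgn d}"
proof -
  define x where "x = (\<lambda>n. tanh (z - F t + F (t + real n)))"
  define y where "y = (\<lambda>n. tanh (l + real n * d + c * (tanh z - x n)))"
  have orbit: "(square_map F c d ^^ n) (tanh z, tanh l) = (x n, y n)" for n
    using square_map_orbit[OF d, where F = F and c = c and z = z and l = l and n = n] by (simp add: x_def y_def t_def)
  have B: "\<bar>c * (tanh z - x n)\<bar> \<le> \<bar>c\<bar> * 2" for n
  proof -
    have "\<bar>tanh z\<bar> < 1" "\<bar>x n\<bar> < 1" by (auto simp: x_def)
    then show ?thesis unfolding abs_mult by (intro mult_left_mono) linarith+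
  qed
  have "y \<longlonglongrightarrow> sgn d"
  proof (cases "d > 0")
    case True
    have "filterlim (\<lambda>n. real n * d + K) at_top sequentially" for K using True by real_asymp
    then have "filterlim (\<lambda>n. l + real n * d + c * (tanh z - x n)) at_top sequentially"
    proof (rule filterlim_at_top_mono, intro always_eventually allI)
      show "real n * d + (l - \<bar>c\<bar> * 2) \<le> l + real n * d + c * (tanh z - x n)" for n
        using B[of n] by linarith
    qed
    then show ?thesis using True unfolding y_def by (simp add: filterlim_compose[OF tanh_real_at_top])
  next
    case False
    then have "d < 0" using d by auto
    have "filterlim (\<lambda>n. real n * d + K) at_bot sequentially" for K using \<open>d < 0\<close> by real_asymp
    then have "filterlim (\<lambda>n. l + real n * d + c * (tanh z - x n)) at_bot sequentially"
    proof (rule filterlim_at_bot_mono, intro always_eventually allI)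
      show "l + real n * d + c * (tanh z - x n) \<le> real n * d + (l + \<bar>c\<bar> * 2)" for n
        using B[of n] by linarith
    qed
    then show ?thesis using \<open>d < 0\<close> unfolding y_def by (simp add: filterlim_compose[OF tanh_real_at_bot])
  qed
  then have y_lim: "(\<lambda>i. y (r i)) \<longlonglongrightarrow> sgn d" if "strict_mono r" for r
    using LIMSEQ_subseq_LIMSEQ[OF _ that] by (auto simp: o_def)
  have "(\<lambda>i. (x (r i), y (r i))) \<longlonglongrightarrow> (u, v) \<longleftrightarrow> (\<lambda>i. x (r i)) \<longlonglongrightarrow> u \<and> v = sgn d"
    if r: "strict_mono r" for r u v
  proof
    assume "(\<lambda>i. (x (r i), y (r i))) \<longlonglongrightarrow> (u, v)"
    from tendsto_fst[OF this] tendsto_snd[OF this]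
    show "(\<lambda>i. x (r i)) \<longlonglongrightarrow> u \<and> v = sgn d"
      using LIMSEQ_unique[OF y_lim[OF r]] by simp
  next
    assume "(\<lambda>i. x (r i)) \<longlonglongrightarrow> u \<and> v = sgn d"
    then show "(\<lambda>i. (x (r i), y (r i))) \<longlonglongrightarrow> (u, v)"
      using y_lim[OF r] by (auto intro: tendsto_Pair)
  qed
  then have "{p. \<exists>r::nat \<Rightarrow> nat. strict_mono r \<and> (\<lambda>i. (x (r i), y (r i))) \<longlonglongrightarrow> p} = cluster_set x \<times> {sgn d}"
    unfolding cluster_set_def by (simp only: set_eq_iff split_paired_all) (simp, blast)
  then show ?thesis
    by (simp only: omega_limit_def orbit flip: x_def)
qed

subsection \<open>Prescribing the drift along countably many orbits\<close>

text \<open>\<open>arsinh\<close> serves as a clock that runs at logarithmic speed towards both ends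
  of the line; this is its advance during one time unit.\<close>

definition delta :: "real \<Rightarrow> real" where
  "delta t = \<bar>arsinh (t + 1) - arsinh t\<bar>"

lemma delta_nonneg: "0 \<le> delta t"
  by (simp add: delta_def)

text \<open>The advance decays like 1/|t|, faster than the logarithmic weight grows. The weight pays
  for amplitudes that grow linearly in the clock.\<close>

lemma delta_tendsto_0: "((\<lambda>t. delta t * (1 + \<bar>arsinh t\<bar>)) \<longlongrightarrow> 0) at_infinity"
proof -
  \<comment> \<open>With \<open>t + 1\<close> in the weight, substituting \<open>- t - 1\<close>
    gives exactly the claimed expression for negative \<open>t\<close>, so one limit serves both
    ends.\<close>
  have top: "((\<lambda>t. (arsinh (t + 1) - arsinh t) * (1 + arsinh (t + 1))) \<longlongrightarrow> (0::real)) at_top"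
    unfolding arsinh_real_def by real_asymp
  have ge: "delta t = arsinh (t + 1) - arsinh t" for t
    using arsinh_less_iff_real[of t "t+1"] by (simp add: delta_def del: arsinh_less_iff_real)
  have "((\<lambda>t. delta t * (1 + \<bar>arsinh t\<bar>)) \<longlongrightarrow> 0) at_top"
  proof (rule tendsto_sandwich[OF _ _ tendsto_const top])
    show "\<forall>\<^sub>F t in at_top. delta t * (1 + \<bar>arsinh t\<bar>) \<le> (arsinh (t + 1) - arsinh t) * (1 + arsinh (t + 1))"
      using eventually_gt_at_top[of 0]
    proof eventually_elim
      case (elim t)
      then show ?case using arsinh_less_iff_real[of t "t+1"] arsinh_real_pos_iff[of t]
        unfolding ge by (intro mult_mono) (auto simp del: arsinh_less_iff_real arsinh_real_pos_iff)
    qed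
  qed (auto simp: delta_def)
  moreover have "((\<lambda>t. delta t * (1 + \<bar>arsinh t\<bar>)) \<longlongrightarrow> 0) at_bot"
  proof -
    have "filterlim (\<lambda>t::real. - t - 1) at_top at_bot" by real_asymp
    from filterlim_compose[OF top this]
    have "((\<lambda>t. (arsinh (-t) - arsinh (- t - 1)) * (1 + arsinh (-t))) \<longlongrightarrow> (0::real)) at_bot" by simp
    moreover have "\<forall>\<^sub>F t in at_bot. (arsinh (-t) - arsinh (- t - 1)) * (1 + arsinh (-t)) = delta t * (1 + \<bar>arsinh t\<bar>)"
      using eventually_gt_at_bot[of 0]
    proof eventually_elim
      case (elim t)
      then have "arsinh t < 0" by simp
      moreover have "arsinh (- t - 1) = - arsinh (t + 1)" by (metis arsinh_minus_real minus_add_distrib uminus_add_conv_diff add.commute minus_diff_eq diff_minus_eq_add)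
      ultimately show ?case using abs_of_neg[of "arsinh t"] by (simp only: ge) simp
    qed
    ultimately show ?thesis by (rule Lim_transform_eventually)
  qed
  ultimately show ?thesis by (simp add: at_infinity_eq_at_top_bot filterlim_sup)
qed

text \<open>
  The last sum ensures that the \<open>i\<close>-th bump vanishes at the orbit points \<open>t j + n\<close>, \<open>j < i\<close>, whenever its
  amplitude does not; the middle one that \<open>F (t j)\<close> involves only the bumps with index less than \<open>j\<close>.
\<close>

definition onset :: "(nat \<Rightarrow> real) \<Rightarrow> nat \<Rightarrow> real" where
  "onset t i = real i + (\<Sum>j\<le>i. \<bar>arsinh (t j)\<bar>) + (\<Sum>j<i. 1 / \<bar>sin (pi * (t j - t i))\<bar>)"

text \<open>The absolute sine is a 1-periodic substitute for the distance from \<open>s\<close> to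
  the translates of \<open>t i\<close> by integers. The bump is 1 on these translates and narrows as
  the clock advances.\<close>

definition bump :: "(nat \<Rightarrow> real) \<Rightarrow> nat \<Rightarrow> real \<Rightarrow> real" where
  "bump t i s = max 0 (1 - \<bar>arsinh s\<bar> * \<bar>sin (pi * (s - t i))\<bar>)"

text \<open>\<open>f\<close> steers the forward and \<open>g\<close> the backward half of the orbit,
  each at rest until the clock passes the onset. The factors \<open>2 ^ i\<close> make the one-step
  changes summable over \<open>i\<close>.\<close>

definition amplitude :: "(nat \<Rightarrow> real) \<Rightarrow> (real \<Rightarrow> real) \<Rightarrow> (real \<Rightarrow> real) \<Rightarrow> nat \<Rightarrow> real \<Rightarrow> real" where
  "amplitude t f g i s = f (max 0 (arsinh s - onset t i) / 2 ^ i) + g (max 0 (- arsinh s - onset t i) / 2 ^ i)"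

lemma sin_pi_add_1: "sin (pi * (s + 1)) = - sin (pi * s)" for s :: real
  by (simp add: distrib_left)

lemma abs_sin_pi_add_nat: "\<bar>sin (pi * (s + real n))\<bar> = \<bar>sin (pi * s)\<bar>" for s :: real
proof (induction n)
  case (Suc n)
  then show ?case using sin_pi_add_1[of "s + real n"] by (simp add: add_ac)
qed simp

lemma abs_sin_pi_diff_nat: "\<bar>sin (pi * (s - real n))\<bar> = \<bar>sin (pi * s)\<bar>" for s :: real
  using abs_sin_pi_add_nat[of "s - real n" n] by simp

lemma sin_pi_eq_0_iff: "sin (pi * s) = 0 \<longleftrightarrow> s \<in> \<int>" for s :: real
  by (auto simp: sin_zero_iff_int2 Ints_def mult.commute)

lemma bump_bounds: "0 \<le> bump t i s" "bump t i s \<le> 1"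
  by (auto simp: bump_def)

text \<open>The sine factor is unchanged by a unit step, so only the clock moves, and truncation at
  0 does not increase differences.\<close>

lemma bump_step: "\<bar>bump t i (s + 1) - bump t i s\<bar> \<le> delta s"
proof -
  have "s + 1 - t i = (s - t i) + 1" by simp
  then have eq: "\<bar>sin (pi * (s + 1 - t i))\<bar> = \<bar>sin (pi * (s - t i))\<bar>"
    by (simp only: sin_pi_add_1 abs_minus_cancel)
  let ?b = "\<bar>sin (pi * (s - t i))\<bar>"
  have "\<bar>\<bar>arsinh (s + 1)\<bar> * ?b - \<bar>arsinh s\<bar> * ?b\<bar> = \<bar>\<bar>arsinh (s + 1)\<bar> - \<bar>arsinh s\<bar>\<bar> * ?b"
    by (simp add: abs_mult flip: left_diff_distrib)
  also have "\<dots> \<le> delta s * 1"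
    by (intro mult_mono) (auto simp: delta_def)
  finally have "\<bar>\<bar>arsinh (s + 1)\<bar> * ?b - \<bar>arsinh s\<bar> * ?b\<bar> \<le> delta s" by simp
  moreover have "\<bar>max 0 (1 - x) - max 0 (1 - y)\<bar> \<le> \<bar>x - y\<bar>" for x y :: real by auto
  ultimately show ?thesis unfolding bump_def eq by (rule order_trans[rotated])
qed

lemma onset_nonneg: "0 \<le> onset t i"
  unfolding onset_def by (intro add_nonneg_nonneg sum_nonneg) auto

lemma onset_ge:
  shows "real i \<le> onset t i"
    and "j \<le> i \<Longrightarrow> \<bar>arsinh (t j)\<bar> \<le> onset t i"
    and "j < i \<Longrightarrow> 1 / \<bar>sin (pi * (t j - t i))\<bar> \<le> onset t i"
proof -
  have a: "(\<Sum>j\<le>i. \<bar>arsinh (t j)\<bar>) \<ge> 0" and b: "(\<Sum>j<i. 1 / \<bar>sin (pi * (t j - t i))\<bar>) \<ge> 0"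
    by (auto intro: sum_nonneg)
  show "real i \<le> onset t i" unfolding onset_def using a b by linarith
  show "\<bar>arsinh (t j)\<bar> \<le> onset t i" if "j \<le> i"
  proof -
    have "\<bar>arsinh (t j)\<bar> \<le> (\<Sum>j\<le>i. \<bar>arsinh (t j)\<bar>)"
      using that by (intro member_le_sum) auto
    then show ?thesis unfolding onset_def using b by linarith
  qed
  show "1 / \<bar>sin (pi * (t j - t i))\<bar> \<le> onset t i" if "j < i"
  proof -
    have "1 / \<bar>sin (pi * (t j - t i))\<bar> \<le> (\<Sum>j<i. 1 / \<bar>sin (pi * (t j - t i))\<bar>)"
      using that by (intro member_le_sum) auto
    then show ?thesis unfolding onset_def using a by linarith
  qed
qed

lemma amplitude_eq_0:
  assumes "f 0 = 0" "g 0 = 0" "\<bar>arsinh s\<bar> \<le> onset t i"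
  shows "amplitude t f g i s = 0"
proof -
  have "max 0 (arsinh s - onset t i) = 0" "max 0 (- arsinh s - onset t i) = 0"
    using assms(3) by linarith+
  then show ?thesis using assms(1,2) by (simp add: amplitude_def)
qed

lemma amplitude_step:
  assumes f: "\<And>x y. \<bar>f x - f y\<bar> \<le> 3 * \<bar>x - y\<bar>" and g: "\<And>x y. \<bar>g x - g y\<bar> \<le> 3 * \<bar>x - y\<bar>"
  shows "\<bar>amplitude t f g i s - amplitude t f g i s'\<bar> \<le> 6 * \<bar>arsinh s - arsinh s'\<bar> / 2 ^ i"
proof -
  define T where "T = onset t i"
  define k :: real where "k = 2 ^ i"
  have "k > 0" by (simp add: k_def)
  have "\<bar>f (max 0 (arsinh s - T) / k) - f (max 0 (arsinh s' - T) / k)\<bar> \<le> 3 * \<bar>max 0 (arsinh s - T) / k - max 0 (arsinh s' - T) / k\<bar>"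
    by (rule f)
  also have "\<dots> = 3 * (\<bar>max 0 (arsinh s - T) - max 0 (arsinh s' - T)\<bar> / k)"
    using \<open>k > 0\<close> by (simp flip: diff_divide_distrib)
  also have "\<dots> \<le> 3 * (\<bar>arsinh s - arsinh s'\<bar> / k)"
    using \<open>k > 0\<close> by (intro mult_left_mono divide_right_mono) auto
  finally have 1: "\<bar>f (max 0 (arsinh s - T) / k) - f (max 0 (arsinh s' - T) / k)\<bar> \<le> 3 * (\<bar>arsinh s - arsinh s'\<bar> / k)" .
  have "\<bar>g (max 0 (- arsinh s - T) / k) - g (max 0 (- arsinh s' - T) / k)\<bar> \<le> 3 * \<bar>max 0 (- arsinh s - T) / k - max 0 (- arsinh s' - T) / k\<bar>"
    by (rule g)
  also have "\<dots> = 3 * (\<bar>max 0 (- arsinh s - T) - max 0 (- arsinh s' - T)\<bar> / k)"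
    using \<open>k > 0\<close> by (simp flip: diff_divide_distrib)
  also have "\<dots> \<le> 3 * (\<bar>arsinh s - arsinh s'\<bar> / k)"
    using \<open>k > 0\<close> by (intro mult_left_mono divide_right_mono) auto
  finally have 2: "\<bar>g (max 0 (- arsinh s - T) / k) - g (max 0 (- arsinh s' - T) / k)\<bar> \<le> 3 * (\<bar>arsinh s - arsinh s'\<bar> / k)" .
  from 1 2 show ?thesis unfolding amplitude_def T_def[symmetric] k_def[symmetric] by linarith
qed

lemma lipschitz_imp_continuous_on:
  fixes f :: "real \<Rightarrow> real"
  assumes f: "\<And>x y. \<bar>f x - f y\<bar> \<le> 3 * \<bar>x - y\<bar>"
  shows "continuous_on A f"
  by (rule lipschitz_on_continuous_on[of 3]) (use f in \<open>auto intro!: lipschitz_onI simp: dist_real_def\<close>)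

text \<open>A locally finite series: if all \<open>f i\<close> and \<open>g i\<close> vanish at 0,
  the cutoff loses nothing, because the onset of index \<open>i\<close> is at least
  \<open>i\<close>.\<close>

definition profile :: "(nat \<Rightarrow> real) \<Rightarrow> (nat \<Rightarrow> real \<Rightarrow> real) \<Rightarrow> (nat \<Rightarrow> real \<Rightarrow> real) \<Rightarrow> real \<Rightarrow> real" where
  "profile t f g s = (\<Sum>i < nat \<lceil>\<bar>arsinh s\<bar>\<rceil>. amplitude t (f i) (g i) i s * bump t i s)"

section \<open>The sum of all bumps: continuity, slow variation, values along the orbits\<close>

context
  fixes t :: "nat \<Rightarrow> real" and f g :: "nat \<Rightarrow> real \<Rightarrow> real"
  assumes f0: "\<And>i. f i 0 = 0" and g0: "\<And>i. g i 0 = 0"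
    and f: "\<And>i x y. \<bar>f i x - f i y\<bar> \<le> 3 * \<bar>x - y\<bar>" and g: "\<And>i x y. \<bar>g i x - g i y\<bar> \<le> 3 * \<bar>x - y\<bar>"
begin

lemma amplitude_before_onset: "\<bar>arsinh s\<bar> \<le> onset t i \<Longrightarrow> amplitude t (f i) (g i) i s = 0"
  by (rule amplitude_eq_0) (auto simp: f0 g0)

text \<open>A common larger cutoff makes it possible to compare values at different points and to
  see continuity locally.\<close>

lemma profile_eq_sum:
  assumes "\<bar>arsinh s\<bar> \<le> real N"
  shows "profile t f g s = (\<Sum>i<N. amplitude t (f i) (g i) i s * bump t i s)"
  unfolding profile_def
proof (rule sum.mono_neutral_left)
  show "{..<nat \<lceil>\<bar>arsinh s\<bar>\<rceil>} \<subseteq> {..<N}" using assms by (auto simp: nat_less_iff less_ceiling_iff)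
  show "\<forall>i\<in>{..<N} - {..<nat \<lceil>\<bar>arsinh s\<bar>\<rceil>}. amplitude t (f i) (g i) i s * bump t i s = 0"
  proof
    fix i assume "i \<in> {..<N} - {..<nat \<lceil>\<bar>arsinh s\<bar>\<rceil>}"
    then have "\<bar>arsinh s\<bar> \<le> real i" by (simp add: not_less nat_le_iff ceiling_le_iff)
    then have "\<bar>arsinh s\<bar> \<le> onset t i" using onset_ge(1)[of i t] by linarith
    then show "amplitude t (f i) (g i) i s * bump t i s = 0"
      by (simp add: amplitude_before_onset)
  qed
qed simp

lemma continuous_on_profile: "continuous_on UNIV (profile t f g)"
proof -
  have "isCont (profile t f g) s" for s
  proof -
    define N where "N = nat \<lceil>\<bar>arsinh s\<bar>\<rceil> + 1"
    have "\<bar>arsinh s\<bar> < real N" unfolding N_def by linarith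
    let ?S = "{s. \<bar>arsinh s\<bar> < real N}"
    have op: "open ?S" by (intro open_Collect_less continuous_intros)
    have "continuous_on ?S (\<lambda>s. \<Sum>i<N. amplitude t (f i) (g i) i s * bump t i s)"
      unfolding amplitude_def bump_def
      by (intro continuous_intros continuous_on_compose2[OF lipschitz_imp_continuous_on[of "f _" UNIV, OF f]]
           continuous_on_compose2[OF lipschitz_imp_continuous_on[of "g _" UNIV, OF g]]) auto
    also have "?this \<longleftrightarrow> continuous_on ?S (profile t f g)"
      by (rule continuous_on_cong) (auto intro!: profile_eq_sum[symmetric])
    finally show ?thesis using op \<open>\<bar>arsinh s\<bar> < real N\<close> by (simp add: continuous_on_eq_continuous_at)
  qed
  then show ?thesis by (simp add: continuous_at_imp_continuous_on)
qed

text \<open>A discrete product rule for amplitude times bump bounds the change of the i-th term by 6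
  / 2^i times the weighted clock step; the geometric series contributes the factor 2.\<close>

lemma profile_step: "\<bar>profile t f g (s + 1) - profile t f g s\<bar> \<le> 12 * (delta s * (1 + \<bar>arsinh s\<bar>))"
proof -
  obtain N where N: "max \<bar>arsinh s\<bar> \<bar>arsinh (s + 1)\<bar> \<le> real N" using real_arch_simple by blast
  let ?a = "\<lambda>i s. amplitude t (f i) (g i) i s" and ?b = "bump t"
  have "\<bar>profile t f g (s + 1) - profile t f g s\<bar> = \<bar>\<Sum>i<N. ?a i (s + 1) * ?b i (s + 1) - ?a i s * ?b i s\<bar>"
    using N by (simp add: profile_eq_sum[of _ N] sum_subtractf)
  also have "\<dots> \<le> (\<Sum>i<N. 6 * (delta s * (1 + \<bar>arsinh s\<bar>)) * (1/2) ^ i)"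
  proof (intro sum_abs[THEN order_trans] sum_mono)
    fix i
    have 1: "\<bar>?a i (s + 1) - ?a i s\<bar> \<le> 6 * delta s / 2 ^ i"
      using amplitude_step[where f = "f i" and g = "g i", OF f g, of t i "s + 1" s] by (simp add: delta_def)
    \<comment> \<open>Comparison with the point 0, where the clock shows 0, bounds the amplitude
      itself linearly in the clock.\<close>
    have "?a i 0 = 0" using f0 g0 onset_nonneg[of t i] by (intro amplitude_eq_0) auto
    then have 2: "\<bar>?a i s\<bar> \<le> 6 * \<bar>arsinh s\<bar> / 2 ^ i"
      using amplitude_step[where f = "f i" and g = "g i", OF f g, of t i s 0] by simp
    have "\<bar>?a i (s + 1) * ?b i (s + 1) - ?a i s * ?b i s\<bar>
        = \<bar>(?a i (s + 1) - ?a i s) * ?b i (s + 1) + ?a i s * (?b i (s + 1) - ?b i s)\<bar>"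
      by (simp add: algebra_simps)
    also have "\<dots> \<le> \<bar>?a i (s + 1) - ?a i s\<bar> * \<bar>?b i (s + 1)\<bar> + \<bar>?a i s\<bar> * \<bar>?b i (s + 1) - ?b i s\<bar>"
      by (metis abs_mult abs_triangle_ineq)
    also have "\<dots> \<le> (6 * delta s / 2 ^ i) * 1 + (6 * \<bar>arsinh s\<bar> / 2 ^ i) * delta s"
    proof (rule add_mono)
      show "\<bar>?a i (s + 1) - ?a i s\<bar> * \<bar>?b i (s + 1)\<bar> \<le> (6 * delta s / 2 ^ i) * 1"
      proof (rule mult_mono[OF 1])
        show "\<bar>?b i (s + 1)\<bar> \<le> 1" using bump_bounds[of t i "s + 1"] by linarith
      qed (simp_all add: delta_nonneg)
      show "\<bar>?a i s\<bar> * \<bar>?b i (s + 1) - ?b i s\<bar> \<le> (6 * \<bar>arsinh s\<bar> / 2 ^ i) * delta s"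
        by (rule mult_mono[OF 2 bump_step]) simp_all
    qed
    also have "\<dots> = 6 * (delta s * (1 + \<bar>arsinh s\<bar>)) * (1/2) ^ i"
      by (simp add: power_one_over distrib_left add_divide_distrib mult_ac)
    finally show "\<bar>?a i (s + 1) * ?b i (s + 1) - ?a i s * ?b i s\<bar> \<le> 6 * (delta s * (1 + \<bar>arsinh s\<bar>)) * (1/2) ^ i" .
  qed
  also have "\<dots> = 6 * (delta s * (1 + \<bar>arsinh s\<bar>)) * (\<Sum>i<N. (1/2) ^ i)"
    by (simp add: sum_distrib_left)
  also have "\<dots> \<le> 6 * (delta s * (1 + \<bar>arsinh s\<bar>)) * 2"
  proof (intro mult_left_mono)
    have "(\<Sum>i<N. (1/2::real) ^ i) = 2 * (1 - (1/2) ^ N)" by (simp add: sum_gp_strict)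
    then show "(\<Sum>i<N. (1/2::real) ^ i) \<le> 2" by simp
  qed (auto simp: delta_def)
  finally show ?thesis by simp
qed

lemma profile_step_tendsto_0: "((\<lambda>s. profile t f g (s + 1) - profile t f g s) \<longlongrightarrow> 0) at_infinity"
proof (rule Lim_null_comparison[OF always_eventually])
  show "\<forall>s. norm (profile t f g (s + 1) - profile t f g s) \<le> 12 * (delta s * (1 + \<bar>arsinh s\<bar>))"
    using profile_step by simp
  show "((\<lambda>s. 12 * (delta s * (1 + \<bar>arsinh s\<bar>))) \<longlongrightarrow> 0) at_infinity"
    using tendsto_mult_left[OF delta_tendsto_0, of 12] by simp
qed

text \<open>For i > j either the i-th amplitude has not started, or the clock exceeds
  \<open>1 / \<bar>sin (pi * (t j - t i))\<bar>\<close> and the i-th bump has already become too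
  narrow to reach the orbit. The j-th bump equals 1 there.\<close>

lemma profile_orbit_truncated:
  assumes distinct: "\<And>i j. i \<noteq> j \<Longrightarrow> t i - t j \<notin> \<int>"
    and s: "\<And>i. \<bar>sin (pi * (s - t i))\<bar> = \<bar>sin (pi * (t j - t i))\<bar>"
  shows "profile t f g s = amplitude t (f j) (g j) j s + (\<Sum>i<j. amplitude t (f i) (g i) i s * bump t i s)"
proof -
  let ?h = "\<lambda>i. amplitude t (f i) (g i) i s * bump t i s"
  have zero: "?h i = 0" if "j < i" for i
  proof (cases "\<bar>arsinh s\<bar> \<le> onset t i")
    case True
    then show ?thesis by (simp add: amplitude_before_onset)
  next
    case False
    have pos: "\<bar>sin (pi * (t j - t i))\<bar> > 0" using distinct[of j i] that by (auto simp: sin_pi_eq_0_iff)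
    have "1 / \<bar>sin (pi * (t j - t i))\<bar> \<le> \<bar>arsinh s\<bar>" using onset_ge(3)[OF that, of t] False by linarith
    then have "bump t i s = 0" using pos by (simp add: bump_def s pos_divide_le_eq)
    then show ?thesis by simp
  qed
  have one: "bump t j s = 1" using s[of j] by (simp add: bump_def)
  obtain N where N: "\<bar>arsinh s\<bar> + real j + 1 \<le> real N" using real_arch_simple by blast
  then have "j < N" "\<bar>arsinh s\<bar> \<le> real N" by linarith+
  then have "profile t f g s = (\<Sum>i<N. ?h i)" by (intro profile_eq_sum)
  also have "\<dots> = (\<Sum>i<Suc j. ?h i)"
    by (rule sum.mono_neutral_right) (use \<open>j < N\<close> zero in auto)
  finally show ?thesis using one by simp
qed

text \<open>The j-th amplitude also vanishes at its own node, since its onset is at least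
  \<open>\<bar>arsinh (t j)\<bar>\<close>. This makes a recursive choice of the starting values
  possible.\<close>

lemma profile_at_node:
  assumes distinct: "\<And>i j. i \<noteq> j \<Longrightarrow> t i - t j \<notin> \<int>"
  shows "profile t f g (t j) = (\<Sum>i<j. amplitude t (f i) (g i) i (t j) * bump t i (t j))"
  using profile_orbit_truncated[OF distinct, of "t j" j] amplitude_before_onset[OF onset_ge(2)[OF order.refl]] by simp

text \<open>Each of the finitely many earlier bumps narrows until it misses the orbit, so eventually
  the j-th amplitude alone remains.\<close>

lemma profile_along_orbit:
  assumes distinct: "\<And>i j. i \<noteq> j \<Longrightarrow> t i - t j \<notin> \<int>"
    and s: "\<And>n i. \<bar>sin (pi * (s n - t i))\<bar> = \<bar>sin (pi * (t j - t i))\<bar>"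
    and lim: "filterlim (\<lambda>n. \<bar>arsinh (s n)\<bar>) at_top sequentially"
  shows "\<forall>\<^sub>F n in sequentially. profile t f g (s n) = amplitude t (f j) (g j) j (s n)"
proof -
  have "\<forall>\<^sub>F n in sequentially. \<forall>i\<in>{..<j}. bump t i (s n) = 0"
  proof (rule eventually_ball_finite)
    show "\<forall>i\<in>{..<j}. \<forall>\<^sub>F n in sequentially. bump t i (s n) = 0"
    proof
      fix i assume "i \<in> {..<j}"
      then have pos: "\<bar>sin (pi * (t j - t i))\<bar> > 0" using distinct[of j i] by (auto simp: sin_pi_eq_0_iff)
      have "\<forall>\<^sub>F n in sequentially. 1 / \<bar>sin (pi * (t j - t i))\<bar> \<le> \<bar>arsinh (s n)\<bar>"
        using lim by (simp add: filterlim_at_top)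
      then show "\<forall>\<^sub>F n in sequentially. bump t i (s n) = 0"
        by eventually_elim (use pos in \<open>simp add: bump_def s pos_divide_le_eq\<close>)
    qed
  qed simp
  then show ?thesis
    by eventually_elim (simp add: profile_orbit_truncated[OF distinct s])
qed

end

text \<open>
  The amplitude of the \<open>j\<close>-th bump has to be chosen relative to the starting value \<open>z j - F (t j)\<close>,
  which depends on the amplitudes of the earlier bumps.
\<close>

fun offset :: "(nat \<Rightarrow> real) \<Rightarrow> (nat \<Rightarrow> nat \<Rightarrow> real \<Rightarrow> real) \<Rightarrow> nat \<Rightarrow> real" where
  "offset z W j = z j - (\<Sum>i<j. W i j (offset z W i))"

declare offset.simps [simp del]

text \<open>Logarithmic growth: unbounded, yet with steps tending to 0, as
  \<open>exists_lipschitz_sweep\<close> demands.\<close>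

lemma slow_ramp:
  fixes k T u :: real
  assumes "k > 0"
  defines "s \<equiv> \<lambda>n. max 0 (arsinh (u + real n) - T) / k"
  shows "filterlim s at_top sequentially" "(\<lambda>n. s (Suc n) - s n) \<longlonglongrightarrow> 0"
proof -
  have lim: "filterlim (\<lambda>n. (arsinh (u + real n) - T) / k) at_top sequentially"
    unfolding arsinh_real_def using assms(1) by real_asymp
  have "\<forall>\<^sub>F n in sequentially. s n = (arsinh (u + real n) - T) / k"
    using lim[unfolded filterlim_at_top, rule_format, of 0]
    by eventually_elim (use assms(1) in \<open>auto simp: s_def zero_le_divide_iff max_def\<close>)
  with lim show "filterlim s at_top sequentially" by (simp cong: filterlim_cong)
  have "((\<lambda>t. arsinh (t + 1) - arsinh t) \<longlongrightarrow> (0::real)) at_top"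
    unfolding arsinh_real_def by real_asymp
  moreover have "filterlim (\<lambda>n. u + real n) at_top sequentially" by real_asymp
  ultimately have "(\<lambda>n. arsinh (u + real n + 1) - arsinh (u + real n)) \<longlonglongrightarrow> 0"
    by (rule filterlim_compose)
  then have "(\<lambda>n. (arsinh (u + real (Suc n)) - arsinh (u + real n)) / k) \<longlonglongrightarrow> 0"
    by (intro tendsto_divide_zero) (simp add: add_ac)
  then show "(\<lambda>n. s (Suc n) - s n) \<longlonglongrightarrow> 0"
  proof (rule Lim_null_comparison[rotated], intro always_eventually allI)
    fix n
    have "arsinh (u + real n) \<le> arsinh (u + real (Suc n))"
      using arsinh_less_iff_real[of "u + real n" "u + real (Suc n)"] by (simp del: arsinh_less_iff_real)
    then have "\<bar>max 0 (arsinh (u + real (Suc n)) - T) - max 0 (arsinh (u + real n) - T)\<bar> \<le> arsinh (u + real (Suc n)) - arsinh (u + real n)"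
      by auto
    then show "norm (s (Suc n) - s n) \<le> (arsinh (u + real (Suc n)) - arsinh (u + real n)) / k"
      using assms(1) unfolding s_def by (simp add: divide_right_mono flip: diff_divide_distrib)
  qed
qed

lemma cluster_set_cong:
  assumes "\<forall>\<^sub>F n in sequentially. a n = b n"
  shows "cluster_set a = cluster_set b"
proof -
  have "(\<lambda>i. a (r i)) \<longlonglongrightarrow> y \<longleftrightarrow> (\<lambda>i. b (r i)) \<longlonglongrightarrow> y" if "strict_mono r" for r y
    by (rule tendsto_cong) (use eventually_subseq[OF that assms] in simp)
  then show ?thesis unfolding cluster_set_def by blast
qed

lemma exists_profile:
  fixes t z p q p' q' :: "nat \<Rightarrow> real"
  assumes distinct: "\<And>i j. i \<noteq> j \<Longrightarrow> t i - t j \<notin> \<int>"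
    and p: "\<And>j. -1 \<le> p j \<and> p j \<le> q j \<and> q j \<le> 1"
    and p': "\<And>j. -1 \<le> p' j \<and> p' j \<le> q' j \<and> q' j \<le> 1"
  shows "\<exists>F. continuous_on UNIV F \<and> ((\<lambda>s. F (s + 1) - F s) \<longlongrightarrow> 0) at_infinity \<and>
    (\<forall>j. cluster_set (\<lambda>n. tanh (z j - F (t j) + F (t j + real n))) = {p j..q j}) \<and>
    (\<forall>j. cluster_set (\<lambda>n. tanh (z j - F (t j) + F (t j - real n))) = {p' j..q' j})"
proof -
  \<comment> \<open>A sweep is chosen for every possible starting value \<open>k\<close>, because
    the right one is known only after the earlier bumps are fixed.\<close>
  have "\<forall>j k. \<exists>f. f 0 = 0 \<and> (\<forall>x y. \<bar>f x - f y\<bar> \<le> 3 * \<bar>x - y\<bar>) \<and>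
    (\<forall>s. filterlim s at_top sequentially \<longrightarrow> (\<lambda>n. s (Suc n) - s n) \<longlonglongrightarrow> 0 \<longrightarrow>
      cluster_set (\<lambda>n. tanh (k + f (s n))) = {p j..q j})"
    using p exists_lipschitz_sweep by blast
  then obtain a where a: "\<And>j k. a j k 0 = (0::real)" "\<And>j k x y. \<bar>a j k x - a j k y\<bar> \<le> 3 * \<bar>x - y\<bar>"
      "\<And>j k s. filterlim s at_top sequentially \<Longrightarrow> (\<lambda>n. s (Suc n) - s n) \<longlonglongrightarrow> 0 \<Longrightarrow>
      cluster_set (\<lambda>n. tanh (k + a j k (s n))) = {p j..q j}" by metis
  have "\<forall>j k. \<exists>f. f 0 = 0 \<and> (\<forall>x y. \<bar>f x - f y\<bar> \<le> 3 * \<bar>x - y\<bar>) \<and>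
    (\<forall>s. filterlim s at_top sequentially \<longrightarrow> (\<lambda>n. s (Suc n) - s n) \<longlonglongrightarrow> 0 \<longrightarrow>
      cluster_set (\<lambda>n. tanh (k + f (s n))) = {p' j..q' j})"
    using p' exists_lipschitz_sweep by blast
  then obtain b where b: "\<And>j k. b j k 0 = (0::real)" "\<And>j k x y. \<bar>b j k x - b j k y\<bar> \<le> 3 * \<bar>x - y\<bar>"
      "\<And>j k s. filterlim s at_top sequentially \<Longrightarrow> (\<lambda>n. s (Suc n) - s n) \<longlonglongrightarrow> 0 \<Longrightarrow>
      cluster_set (\<lambda>n. tanh (k + b j k (s n))) = {p' j..q' j}" by metis
  \<comment> \<open>The contribution of the i-th bump at the j-th node if its starting value is
    \<open>k\<close>; the recursion \<open>offset\<close> subtracts these for i < j.\<close>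
  define W where "W i j k = amplitude t (a i k) (b i k) i (t j) * bump t i (t j)" for i j k
  define k where "k = offset z W"
  define f where "f j = a j (k j)" for j
  define g where "g j = b j (k j)" for j
  have fg: "f j 0 = 0" "g j 0 = 0" "\<bar>f j x - f j y\<bar> \<le> 3 * \<bar>x - y\<bar>" "\<bar>g j x - g j y\<bar> \<le> 3 * \<bar>x - y\<bar>" for j x y
    using a b by (simp_all add: f_def g_def)
  let ?F = "profile t f g"
  have k: "k j = z j - ?F (t j)" for j
    using profile_at_node[where f = f and g = g and t = t and j = j, OF fg distinct] offset.simps[of z W j]
    by (simp add: W_def f_def g_def k_def)
  show ?thesis
  proof (intro exI[of _ ?F] conjI allI)
    show "continuous_on UNIV ?F" by (rule continuous_on_profile[where f = f and g = g, OF fg])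
    show "((\<lambda>s. ?F (s + 1) - ?F s) \<longlongrightarrow> 0) at_infinity" by (rule profile_step_tendsto_0[where f = f and g = g, OF fg])
    fix j
    have up: "filterlim (\<lambda>n. arsinh (u + real n)) at_top sequentially" for u :: real
      unfolding arsinh_real_def by real_asymp
    have "\<forall>\<^sub>F n in sequentially. ?F (t j + real n) = amplitude t (f j) (g j) j (t j + real n)"
    proof (rule profile_along_orbit[where f = f and g = g and t = t, OF fg distinct])
      show "\<bar>sin (pi * (t j + real n - t i))\<bar> = \<bar>sin (pi * (t j - t i))\<bar>" for n i
        using abs_sin_pi_add_nat[of "t j - t i" n] by (simp add: algebra_simps)
      show "filterlim (\<lambda>n. \<bar>arsinh (t j + real n)\<bar>) at_top sequentially"
        by (rule filterlim_at_top_mono[OF up[of "t j"]]) (auto intro!: always_eventually)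
    qed
    moreover have "\<forall>\<^sub>F n in sequentially. arsinh (t j + real n) \<ge> 0"
      using up by (simp only: filterlim_at_top)
    ultimately have "\<forall>\<^sub>F n in sequentially. tanh (z j - ?F (t j) + ?F (t j + real n)) =
        tanh (k j + f j (max 0 (arsinh (t j + real n) - onset t j) / 2 ^ j))"
    proof eventually_elim
      case (elim n)
      \<comment> \<open>Once the clock is nonnegative, the backward sweep is evaluated at 0 and
        drops out.\<close>
      then have "max 0 (- arsinh (t j + real n) - onset t j) = 0" using onset_nonneg[of t j] by simp
      then show ?case using elim fg(2) by (simp only: amplitude_def k) simp
    qed
    from cluster_set_cong[OF this]
    show "cluster_set (\<lambda>n. tanh (z j - ?F (t j) + ?F (t j + real n))) = {p j..q j}"
      using a(3)[OF slow_ramp[of "2 ^ j" "t j" "onset t j"], of "k j" j] by (simp add: f_def)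
    have minus: "arsinh (t j - real n) = - arsinh (- t j + real n)" for n
      using arsinh_minus_real[of "- t j + real n"] by simp
    have "\<forall>\<^sub>F n in sequentially. ?F (t j - real n) = amplitude t (f j) (g j) j (t j - real n)"
    proof (rule profile_along_orbit[where f = f and g = g and t = t, OF fg distinct])
      show "\<bar>sin (pi * (t j - real n - t i))\<bar> = \<bar>sin (pi * (t j - t i))\<bar>" for n i
        using abs_sin_pi_diff_nat[of "t j - t i" n] by (simp add: algebra_simps)
      show "filterlim (\<lambda>n. \<bar>arsinh (t j - real n)\<bar>) at_top sequentially"
        by (rule filterlim_at_top_mono[OF up[of "- t j"]], intro always_eventually allI) (simp only: minus abs_minus_cancel abs_ge_self)
    qed
    moreover have "\<forall>\<^sub>F n in sequentially. arsinh (- t j + real n) \<ge> 0"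
      using up by (simp only: filterlim_at_top)
    ultimately have "\<forall>\<^sub>F n in sequentially. tanh (z j - ?F (t j) + ?F (t j - real n)) =
        tanh (k j + g j (max 0 (arsinh (- t j + real n) - onset t j) / 2 ^ j))"
    proof eventually_elim
      case (elim n)
      then have "max 0 (- arsinh (- t j + real n) - onset t j) = 0" using onset_nonneg[of t j] by simp
      then show ?case using elim fg(1) by (simp only: amplitude_def k minus) simp
    qed
    from cluster_set_cong[OF this]
    show "cluster_set (\<lambda>n. tanh (z j - ?F (t j) + ?F (t j - real n))) = {p' j..q' j}"
      using b(3)[OF slow_ramp[of "2 ^ j" "- t j" "onset t j"], of "k j" j] by (simp add: g_def)
  qed
qed

subsection \<open>General position\<close>

lemma connected_closed_subset_Jline:
  assumes "C \<noteq> {}" "connected C" "closed C" "C \<subseteq> Jline s"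
  obtains p q where "-1 \<le> p" "p \<le> q" "q \<le> 1" "C = {p..q} \<times> {s}"
proof -
  have "bounded (Jline s)" by (auto simp: Jline_def J_def intro!: bounded_Times)
  then have "compact C" using assms by (meson bounded_subset compact_eq_bounded_closed)
  then have "compact (fst ` C)" by (intro compact_continuous_image continuous_intros)
  moreover have "connected (fst ` C)" by (intro connected_continuous_image continuous_intros assms)
  ultimately obtain p q where pq: "fst ` C = {p..q}"
    using connected_compact_interval_1[of "fst ` C"] by auto
  have "{p..q} \<noteq> {}" "{p..q} \<subseteq> {-1..1}"
    using assms pq[symmetric] by (auto simp: Jline_def J_def)
  then have "-1 \<le> p" "p \<le> q" "q \<le> 1" by auto
  moreover have "C = fst ` C \<times> {s}" using assms(4) by (force simp: Jline_def)
  ultimately show thesis using that pq by simp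
qed

text \<open>Two distinct points with the same sheared value must differ in the first coordinate, and
  they determine \<open>c\<close>; so countably many \<open>c\<close> are excluded. For the
  remaining ones a height difference equal to an integer forces that integer to be nonzero and
  determines \<open>d\<close>, again excluding countably many.\<close>

lemma exists_generic_shear:
  fixes S :: "(real \<times> real) set"
  assumes S: "countable S" "S \<subseteq> {-1<..<1} \<times> {-1<..<1}"
  obtains c d where "d > 0"
    "\<And>u v. u \<in> S \<Longrightarrow> v \<in> S \<Longrightarrow> u \<noteq> v \<Longrightarrow> height c d u - height c d v \<notin> \<int>"
proof -
  define bad where "bad = (\<lambda>(u, v). (artanh (snd v) - artanh (snd u)) / (fst u - fst v)) ` (S \<times> S)"
  have "countable bad" unfolding bad_def using S(1) by simp
  then obtain c where c: "c \<notin> bad" using uncountable_UNIV_real by (metis UNIV_eq_I)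
  let ?h = "\<lambda>u. artanh (snd u) + c * fst u"
  have ne: "?h u \<noteq> ?h v" if uv: "u \<in> S" "v \<in> S" "u \<noteq> v" for u v
  proof
    assume eq: "?h u = ?h v"
    show False
    proof (cases "fst u = fst v")
      case True
      with eq have "artanh (snd u) = artanh (snd v)" by simp
      moreover have "\<bar>snd u\<bar> < 1" "\<bar>snd v\<bar> < 1" using subsetD[OF S(2) uv(1)] subsetD[OF S(2) uv(2)] by (auto simp: mem_Times_iff)
      ultimately have "snd u = snd v" by (metis tanh_artanh_real)
      then show False using True uv(3) by (simp add: prod_eq_iff)
    next
      case False
      then have "c = (artanh (snd v) - artanh (snd u)) / (fst u - fst v)"
        using eq by (simp add: field_simps)
      then have "c \<in> bad" unfolding bad_def using uv by force
      then show False using c by simp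
    qed
  qed
  define bad' where "bad' = (\<lambda>(u, v, k::int). (?h u - ?h v) / of_int k) ` (S \<times> S \<times> UNIV)"
  have "countable bad'" unfolding bad'_def using S(1) by simp
  moreover have "uncountable {0<..<1::real}" by (simp add: uncountable_open_interval)
  ultimately obtain d where d: "d \<in> {0<..<1}" "d \<notin> bad'" by (meson countable_subset subsetI)
  show thesis
  proof
    show "d > 0" using d by simp
    fix u v assume uv: "u \<in> S" "v \<in> S" "u \<noteq> v"
    show "height c d u - height c d v \<notin> \<int>"
    proof
      assume "height c d u - height c d v \<in> \<int>"
      then obtain k :: int where k: "height c d u - height c d v = of_int k" by (auto elim: Ints_cases)
      then have h: "?h u - ?h v = of_int k * d"
        using d by (simp add: height_def field_simps)
      then have "k \<noteq> 0" using ne[OF uv] by auto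
      then have "d = (?h u - ?h v) / of_int k" using h by simp
      then have "d \<in> bad'" unfolding bad'_def using uv by force
      then show False using d by simp
    qed
  qed
qed

theorem theorem3p5:
  fixes V :: "nat \<Rightarrow> (real \<times> real) set"
    and w :: "nat \<Rightarrow> (real \<times> real) set"
    and a :: "nat \<Rightarrow> (real \<times> real) set"
  assumes disj: "\<And>m n. m \<noteq> n \<Longrightarrow> V m \<inter> V n = {}"
    and cnt: "\<And>n. countable (V n)"
    and sub: "\<And>n. V n \<subseteq> {-1<..<1} \<times> {-1<..<1}"
    and dense: "\<And>n. J2 \<subseteq> closure (V n)"
    and w: "\<And>n. w n \<in> A_top"
    and a: "\<And>n. a n \<in> A_bot"
  shows "\<exists>\<phi> \<psi>. homeomorphism J2 J2 \<phi> \<psi> \<and>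
           (\<forall>n. \<forall>x\<in>V n. omega_limit \<phi> x = w n \<and> omega_limit \<psi> x = a n)"
proof -
  have "\<exists>p q. -1 \<le> p \<and> p \<le> q \<and> q \<le> 1 \<and> w n = {p..q} \<times> {1}" for n
  proof -
    have "w n \<noteq> {}" "connected (w n)" "closed (w n)" "w n \<subseteq> Jline 1"
      using w[of n] by (simp_all add: A_top_def)
    then obtain p q where "-1 \<le> p" "p \<le> q" "q \<le> 1" "w n = {p..q} \<times> {1}" by (rule connected_closed_subset_Jline)
    then show ?thesis by metis
  qed
  then obtain p q where pq: "\<And>n. -1 \<le> p n \<and> p n \<le> q n \<and> q n \<le> (1::real)" "\<And>n. w n = {p n..q n} \<times> {1}"
    by metis
  have "\<exists>p q. -1 \<le> p \<and> p \<le> q \<and> q \<le> 1 \<and> a n = {p..q} \<times> {-1}" for n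
  proof -
    have "a n \<noteq> {}" "connected (a n)" "closed (a n)" "a n \<subseteq> Jline (-1)"
      using a[of n] by (simp_all add: A_bot_def)
    then obtain p q where "-1 \<le> p" "p \<le> q" "q \<le> 1" "a n = {p..q} \<times> {-1}" by (rule connected_closed_subset_Jline)
    then show ?thesis by metis
  qed
  then obtain p' q' where pq': "\<And>n. -1 \<le> p' n \<and> p' n \<le> q' n \<and> q' n \<le> (1::real)" "\<And>n. a n = {p' n..q' n} \<times> {-1}"
    by metis
  define S where "S = (\<Union>n. V n)"
  have S: "countable S" "S \<subseteq> {-1<..<1} \<times> {-1<..<1}" using cnt sub by (auto simp: S_def)
  \<comment> \<open>Needed for an enumeration by all natural numbers without repetition. A finite
    dense \<open>V 0\<close> would be closed and contain the corner (1,1), which lies outside the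
    open square.\<close>
  have "infinite S"
  proof
    assume "finite S"
    then have "finite (V 0)" by (rule rev_finite_subset) (auto simp: S_def)
    then have "closure (V 0) = V 0" by (intro closure_closed finite_imp_closed)
    moreover have "(1, 1) \<in> J2" by (simp add: J2_def J_def)
    ultimately show False using dense[of 0] sub[of 0] by auto
  qed
  with S(1) obtain e :: "nat \<Rightarrow> real \<times> real" where e: "bij_betw e UNIV S"
    using bij_betw_from_nat_into by blast
  then have eS: "e j \<in> S" for j by (auto simp: bij_betw_def)
  have "\<forall>j. \<exists>n. e j \<in> V n" using eS by (auto simp: S_def)
  then obtain colour where colour: "\<And>j. e j \<in> V (colour j)" by metis
  obtain c d where d: "d > 0"
    and generic: "\<And>u v. u \<in> S \<Longrightarrow> v \<in> S \<Longrightarrow> u \<noteq> v \<Longrightarrow> height c d u - height c d v \<notin> \<int>"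
    using exists_generic_shear[OF S] by metis
  define t where "t j = height c d (e j)" for j
  define z where "z j = artanh (fst (e j))" for j
  define l where "l j = artanh (snd (e j))" for j
  have e_eq: "e j = (tanh (z j), tanh (l j))" for j
  proof -
    have "\<bar>fst (e j)\<bar> < 1" "\<bar>snd (e j)\<bar> < 1"
      using subsetD[OF S(2) eS[of j]] by (auto simp: mem_Times_iff)
    then show ?thesis by (simp add: z_def l_def)
  qed
  have distinct: "t i - t j \<notin> \<int>" if "i \<noteq> j" for i j
    unfolding t_def using generic[OF eS eS, of i j] that e by (metis bij_betw_def injD)
  have "\<exists>F. continuous_on UNIV F \<and> ((\<lambda>s. F (s + 1) - F s) \<longlongrightarrow> 0) at_infinity \<and>
    (\<forall>j. cluster_set (\<lambda>n. tanh (z j - F (t j) + F (t j + real n))) = {p (colour j)..q (colour j)}) \<and>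
    (\<forall>j. cluster_set (\<lambda>n. tanh (z j - F (t j) + F (t j - real n))) = {p' (colour j)..q' (colour j)})"
    by (rule exists_profile[OF distinct pq(1) pq'(1)])
  then obtain F where F: "continuous_on UNIV F" "((\<lambda>s. F (s + 1) - F s) \<longlongrightarrow> 0) at_infinity"
    and fwd: "\<forall>j. cluster_set (\<lambda>n. tanh (z j - F (t j) + F (t j + real n))) = {p (colour j)..q (colour j)}"
    and bwd: "\<forall>j. cluster_set (\<lambda>n. tanh (z j - F (t j) + F (t j - real n))) = {p' (colour j)..q' (colour j)}"
    by blast
  let ?\<phi> = "square_map F c d" and ?\<psi> = "square_map (\<lambda>t. F (-t)) c (-d)"
  have "homeomorphism J2 J2 ?\<phi> ?\<psi>" using homeomorphism_square_map[OF F] d by simp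
  moreover have "omega_limit ?\<phi> x = w n \<and> omega_limit ?\<psi> x = a n" if x: "x \<in> V n" for n x
  proof -
    have "x \<in> S" using x by (auto simp: S_def)
    then obtain j where j: "x = e j" using bij_betw_imp_surj_on[OF e] by blast
    \<comment> \<open>Disjointness makes the index of the set containing a point unique.\<close>
    then have n: "n = colour j" using disj[of n "colour j"] colour[of j] x by blast
    have t: "t j = height c d (tanh (z j), tanh (l j))" by (simp add: t_def e_eq)
    have "omega_limit ?\<phi> x = w n"
      using omega_limit_square_map[where F = F and c = c and d = d and z = "z j" and l = "l j"] d fwd[rule_format, of j]
      by (simp add: j n e_eq pq(2) flip: t)
    moreover have "omega_limit ?\<psi> x = a n"
      \<comment> \<open>For the inverse map the height of \<open>e j\<close> is
        \<open>- t j\<close>, so the reflected function at \<open>- t j + real n\<close> is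
        \<open>F (t j - real n)\<close>, and \<open>sgn (-d)\<close> = -1 selects the bottom
        edge.\<close>
      using omega_limit_square_map[where F = "\<lambda>t. F (-t)" and c = c and d = "-d" and z = "z j" and l = "l j"] d bwd[rule_format, of j]
      by (simp add: j n e_eq pq'(2) height_uminus flip: t)
    ultimately show ?thesis ..
  qed
  ultimately show ?thesis by blast
qed

end
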